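(* Let $(X,d)$ be a proper geodesic metric space that is uniformly smooth. Then for every ray $\gamma:[0,\infty)\to X$ the Busemann function $b_\gamma$ is quasi-convex. In particular, all Cheeger-Gromoll functions $b_{x_0}$, $x_0\in X$, are quasi-convex.
   Context: A geodesic from $x$ to $y$ is a map $\gamma:[0,1]\to X$ with $\gamma(0)=x$, $\gamma(1)=y$ and $d(\gamma(t),\gamma(s))=|t-s|\,d(x,y)$; $X$ is geodesic if any two points are joined by a geodesic, and proper if closed bounded subsets are compact. A midpoint of $y,z$ is a point $m$ with $d(y,m)=d(m,z)=\frac12d(y,z)$. $(X,d)$ is uniformly smooth if there is a non-decreasing function $\rho:(0,\infty)\to[0,\infty)$ with $\rho(\epsilon)/\epsilon\to0$ as $\epsilon\to0$ such that for all $\epsilon>0$ and all $x,y,z\in X$ with $d(y,z)\le\epsilon\min\{d(x,y),d(x,z)\}$ and every midpoint $m$ of $y$ and $z$, $d(x,m)\ge(1-\rho(\epsilon))\min\{d(x,y),d(x,z)\}$. A ray is an isometric embedding $\gamma:[0,\infty)\to X$; its Busemann function is $b_\gamma(x)=\lim_{t\to\infty}\big(t-d(\gamma(t),x)\big)$. The Cheeger-Gromoll function with respect to $x_0$ is $b_{x_0}(x)=\sup b_\gamma(x)$, the supremum over all rays $\gamma$ with $\gamma(0)=x_0$ (it is considered when at least one such ray exists). A function $f:X\to\mathbb{R}$ is quasi-convex if $f(\gamma(t))\le\max\{f(\gamma(0)),f(\gamma(1))\}$ for every geodesic $\gamma:[0,1]\to X$ and $t\in[0,1]$. *)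

theory Defs
  imports "HOL-Analysis.Analysis"
begin

text \<open>The space \<open>X\<close> is the type \<open>'a\<close> itself. Curves are total functions on the
  reals of which only the values on the intended parameter interval are constrained or used.\<close>

definition geodesic_from_to :: "'a::metric_space \<Rightarrow> 'a \<Rightarrow> (real \<Rightarrow> 'a) \<Rightarrow> bool" where
  "geodesic_from_to x y \<gamma> \<longleftrightarrow>
     \<gamma> 0 = x \<and> \<gamma> 1 = y \<and>
     (\<forall>s\<in>{0..1}. \<forall>t\<in>{0..1}. dist (\<gamma> t) (\<gamma> s) = \<bar>t - s\<bar> * dist x y)"

definition geodesic_space :: "'a::metric_space itself \<Rightarrow> bool" where
  "geodesic_space _ \<longleftrightarrow> (\<forall>x y :: 'a. \<exists>\<gamma>. geodesic_from_to x y \<gamma>)"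

definition proper_space :: "'a::metric_space itself \<Rightarrow> bool" where
  "proper_space _ \<longleftrightarrow> (\<forall>S :: 'a set. closed S \<and> bounded S \<longrightarrow> compact S)"

definition is_midpoint :: "'a::metric_space \<Rightarrow> 'a \<Rightarrow> 'a \<Rightarrow> bool" where
  "is_midpoint m y z \<longleftrightarrow> dist y m = dist y z / 2 \<and> dist m z = dist y z / 2"

definition uniformly_smooth :: "'a::metric_space itself \<Rightarrow> bool" where
  "uniformly_smooth _ \<longleftrightarrow>
     (\<exists>\<rho> :: real \<Rightarrow> real.
        mono_on {0<..} \<rho> \<and> (\<forall>\<epsilon>>0. 0 \<le> \<rho> \<epsilon>) \<and>
        ((\<lambda>\<epsilon>. \<rho> \<epsilon> / \<epsilon>) \<longlongrightarrow> 0) (at_right 0) \<and>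
        (\<forall>\<epsilon>>0. \<forall>x y z :: 'a.
           dist y z \<le> \<epsilon> * min (dist x y) (dist x z) \<longrightarrow>
           (\<forall>m. is_midpoint m y z \<longrightarrow>
              (1 - \<rho> \<epsilon>) * min (dist x y) (dist x z) \<le> dist x m)))"

definition is_ray :: "(real \<Rightarrow> 'a::metric_space) \<Rightarrow> bool" where
  "is_ray \<gamma> \<longleftrightarrow> (\<forall>s\<ge>0. \<forall>t\<ge>0. dist (\<gamma> s) (\<gamma> t) = \<bar>s - t\<bar>)"

definition busemann :: "(real \<Rightarrow> 'a::metric_space) \<Rightarrow> 'a \<Rightarrow> real" where
  "busemann \<gamma> x = Lim at_top (\<lambda>t. t - dist (\<gamma> t) x)"

text \<open>A real supremum, meaningful when some ray starts at \<open>x\<^sub>0\<close>; see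
  \<open>bdd_above_busemann\<close> below for boundedness.\<close>

definition cheeger_gromoll :: "'a::metric_space \<Rightarrow> 'a \<Rightarrow> real" where
  "cheeger_gromoll x\<^sub>0 x = (SUP \<gamma> \<in> {\<gamma>. is_ray \<gamma> \<and> \<gamma> 0 = x\<^sub>0}. busemann \<gamma> x)"

definition quasi_convex :: "('a::metric_space \<Rightarrow> real) \<Rightarrow> bool" where
  "quasi_convex f \<longleftrightarrow>
     (\<forall>x y \<gamma>. geodesic_from_to x y \<gamma> \<longrightarrow>
        (\<forall>t\<in>{0..1}. f (\<gamma> t) \<le> max (f (\<gamma> 0)) (f (\<gamma> 1))))"

text \<open>The limit and the supremum above are genuine, so \<open>Lim\<close> and \<open>SUP\<close> do not return
  default values.\<close>

lemma ray_defect_le: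
  assumes "is_ray \<gamma>" "0 \<le> t"
  shows "t - dist (\<gamma> t) x \<le> dist (\<gamma> 0) x"
proof -
  have "dist (\<gamma> 0) (\<gamma> t) = t"
    using assms unfolding is_ray_def by force
  then show ?thesis
    using dist_triangle[of "\<gamma> 0" "\<gamma> t" x] by (simp add: dist_commute)
qed

lemma busemann_tendsto:
  assumes "is_ray \<gamma>"
  shows "((\<lambda>t. t - dist (\<gamma> t) x) \<longlongrightarrow> busemann \<gamma> x) at_top"
proof -
  define g where "g t = t - dist (\<gamma> t) x" for t
  define L where "L = (SUP t\<in>{0..}. g t)"
  have bdd: "bdd_above (g ` {0..})"
    using ray_defect_le[OF assms] unfolding g_def bdd_above_def by fastforce
  have mono: "g s \<le> g t" if "0 \<le> s" "s \<le> t" for s t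
  proof -
    have "dist (\<gamma> t) (\<gamma> s) = t - s"
      using assms that unfolding is_ray_def by force
    then show ?thesis
      using dist_triangle[of "\<gamma> t" x "\<gamma> s"] by (simp add: g_def)
  qed
  have "(g \<longlongrightarrow> L) at_top"
  proof (rule order_tendstoI)
    fix a assume "a < L"
    then obtain s where "0 \<le> s" "a < g s"
      using less_cSUP_iff[OF _ bdd] unfolding L_def by auto
    then have "\<forall>t\<ge>s. a < g t"
      using mono less_le_trans by blast
    then show "eventually (\<lambda>t. a < g t) at_top"
      unfolding eventually_at_top_linorder by blast
  next
    fix a assume "L < a"
    have "\<forall>t\<ge>0. g t \<le> L"
      unfolding L_def using cSUP_upper[OF _ bdd] by simp
    then have "\<forall>t\<ge>0. g t < a"
      using \<open>L < a\<close> le_less_trans by blast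
    then show "eventually (\<lambda>t. g t < a) at_top"
      unfolding eventually_at_top_linorder by blast
  qed
  then have lim: "((\<lambda>t. t - dist (\<gamma> t) x) \<longlongrightarrow> L) at_top"
    by (simp add: g_def[abs_def])
  then have "busemann \<gamma> x = L"
    unfolding busemann_def by (intro tendsto_Lim) simp_all
  with lim show ?thesis by simp
qed

lemma bdd_above_busemann:
  "bdd_above ((\<lambda>\<gamma>. busemann \<gamma> x) ` {\<gamma>. is_ray \<gamma> \<and> \<gamma> 0 = x\<^sub>0})"
proof (rule bdd_aboveI2)
  fix \<gamma> assume "\<gamma> \<in> {\<gamma>. is_ray \<gamma> \<and> \<gamma> 0 = x\<^sub>0}"
  then have ray: "is_ray \<gamma>" and "\<gamma> 0 = x\<^sub>0" by auto
  have "eventually (\<lambda>t. t - dist (\<gamma> t) x \<le> dist (\<gamma> 0) x) at_top"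
    using ray_defect_le[OF ray] unfolding eventually_at_top_linorder by blast
  then have "busemann \<gamma> x \<le> dist (\<gamma> 0) x"
    by (intro tendsto_upperbound[OF busemann_tendsto[OF ray]]) simp_all
  then show "busemann \<gamma> x \<le> dist x\<^sub>0 x" using \<open>\<gamma> 0 = x\<^sub>0\<close> by simp
qed

end

theory Submission
  imports Defs
begin

text \<open>Let \<open>m\<close> be a midpoint of \<open>y \<noteq> z\<close> and let \<open>R\<close> be the smaller of the distances from
  \<open>\<gamma> t\<close> to \<open>y\<close> and \<open>z\<close>. Uniform smoothness with \<open>\<epsilon> = d(y,z) / R\<close> gives
  \<open>d(\<gamma> t, m) \<ge> R - d(y,z) \<rho>(\<epsilon>) / \<epsilon>\<close>, and \<open>\<epsilon> \<rightarrow> 0\<close> as \<open>t \<rightarrow> \<infinity>\<close>, so in the limit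
  \<open>b(m) \<le> max (b y) (b z)\<close>. Continuity of \<open>b\<close> upgrades this to all points of a geodesic: if
  \<open>b\<close> exceeded the maximum \<open>M\<close> of its endpoint values somewhere, then the midpoint of a
  component of \<open>{b > M}\<close> would contradict the midpoint inequality. Finally, quasi-convexity
  passes to suprema.\<close>

lemma busemann_midpoint_le:
  fixes \<gamma> :: "real \<Rightarrow> 'a::metric_space"
  assumes us: "uniformly_smooth TYPE('a)" and ray: "is_ray \<gamma>" and mid: "is_midpoint m y z"
  shows "busemann \<gamma> m \<le> max (busemann \<gamma> y) (busemann \<gamma> z)"
proof (cases "y = z")
  \<comment> \<open>This case stands apart because \<open>d / R t\<close> would be 0 here, while
    smoothness requires \<epsilon> > 0; the midpoint simply coincides with \<open>y\<close>.\<close>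
  case True
  then have "dist y m = 0" using mid unfolding is_midpoint_def by (metis dist_self div_0)
  then show ?thesis by simp
next
  case False
  define d where "d = dist y z"
  have d: "d > 0" using False by (simp add: d_def)
  from us obtain \<rho> :: "real \<Rightarrow> real" where lim: "((\<lambda>\<epsilon>. \<rho> \<epsilon> / \<epsilon>) \<longlongrightarrow> 0) (at_right 0)"
    and \<rho>: "\<forall>\<epsilon>>0. \<forall>x y z :: 'a. dist y z \<le> \<epsilon> * min (dist x y) (dist x z) \<longrightarrow>
      (\<forall>m. is_midpoint m y z \<longrightarrow> (1 - \<rho> \<epsilon>) * min (dist x y) (dist x z) \<le> dist x m)"
    unfolding uniformly_smooth_def by (elim exE conjE) (rule that)
  define R where "R t = min (dist (\<gamma> t) y) (dist (\<gamma> t) z)" for t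
  \<comment> \<open>Subtracting from \<open>t\<close> turns the minimum of distances into a maximum
    of Busemann approximants, which is where the \<open>max\<close> in the claim comes from.\<close>
  have R_eq: "t - R t = max (t - dist (\<gamma> t) y) (t - dist (\<gamma> t) z)" for t
    by (simp add: R_def min_def max_def)
  have R_lim: "((\<lambda>t. t - R t) \<longlongrightarrow> max (busemann \<gamma> y) (busemann \<gamma> z)) at_top"
    unfolding R_eq by (intro tendsto_max busemann_tendsto ray)
  \<comment> \<open>\<open>R t\<close> is \<open>t\<close> minus the convergent quantity
    \<open>t - R t\<close>.\<close>
  have R_top: "filterlim R at_top at_top"
    using filterlim_tendsto_add_at_top[OF tendsto_minus[OF R_lim] filterlim_ident] by simp
  have R_pos: "\<forall>\<^sub>F t in at_top. R t > 0"
    using R_top by (simp add: filterlim_at_top_dense)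
  have "((\<lambda>t. d / R t) \<longlongrightarrow> 0) at_top"
    by (rule real_tendsto_divide_at_top[OF tendsto_const R_top])
  \<comment> \<open>Positivity is needed because the limit of
    \<open>\<rho> \<epsilon> / \<epsilon>\<close> is one-sided.\<close>
  moreover have "\<forall>\<^sub>F t in at_top. d / R t > 0"
    using R_pos by eventually_elim (simp add: d)
  ultimately have "filterlim (\<lambda>t. d / R t) (at_right 0) at_top"
    by (rule tendsto_imp_filterlim_at_right)
  then have "((\<lambda>t. \<rho> (d / R t) / (d / R t)) \<longlongrightarrow> 0) at_top"
    by (rule filterlim_compose[OF lim])
  from tendsto_add[OF R_lim tendsto_mult[OF tendsto_const[of d] this]]
  have upper: "((\<lambda>t. t - R t + d * (\<rho> (d / R t) / (d / R t)))
      \<longlongrightarrow> max (busemann \<gamma> y) (busemann \<gamma> z)) at_top"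
    by simp
  have "\<forall>\<^sub>F t in at_top. t - dist (\<gamma> t) m \<le> t - R t + d * (\<rho> (d / R t) / (d / R t))"
    using R_pos
  proof eventually_elim
    case (elim t)
    \<comment> \<open>With \<epsilon> = \<open>d / R t\<close> the smoothness premise holds with
      equality, and the loss \<open>\<rho> \<epsilon> * R t\<close> equals
      \<open>d * (\<rho> \<epsilon> / \<epsilon>)\<close>.\<close>
    have "(1 - \<rho> (d / R t)) * R t \<le> dist (\<gamma> t) m"
      using \<rho>[rule_format, of "d / R t" y z "\<gamma> t", OF _ _ mid] elim d
      by (simp add: R_def[symmetric] d_def[symmetric])
    then show ?case
      using elim d by (simp add: algebra_simps)
  qed
  then show ?thesis
    by (rule tendsto_le[OF trivial_limit_at_top_linorder upper busemann_tendsto[OF ray]])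
qed

text \<open>By the triangle inequality every approximant \<open>t - dist (\<gamma> t) x\<close> is
  1-Lipschitz in \<open>x\<close>, and this bound survives the limit.\<close>

lemma busemann_diff_le:
  assumes "is_ray \<gamma>"
  shows "busemann \<gamma> x - busemann \<gamma> y \<le> dist x y"
proof (rule tendsto_upperbound)
  show "((\<lambda>t. (t - dist (\<gamma> t) x) - (t - dist (\<gamma> t) y)) \<longlongrightarrow> busemann \<gamma> x - busemann \<gamma> y) at_top"
    by (intro tendsto_diff[OF busemann_tendsto busemann_tendsto] assms)
  show "\<forall>\<^sub>F t in at_top. (t - dist (\<gamma> t) x) - (t - dist (\<gamma> t) y) \<le> dist x y"
  proof (intro always_eventually allI)
    show "(t - dist (\<gamma> t) x) - (t - dist (\<gamma> t) y) \<le> dist x y" for t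
      using dist_triangle[of "\<gamma> t" y x] by simp
  qed
qed simp

lemma continuous_on_busemann:
  assumes "is_ray \<gamma>"
  shows "continuous_on S (busemann \<gamma>)"
proof (rule lipschitz_on_continuous_on)
  show "1-lipschitz_on S (busemann \<gamma>)"
  proof (rule lipschitz_onI)
    show "dist (busemann \<gamma> x) (busemann \<gamma> y) \<le> 1 * dist x y" for x y
      using busemann_diff_le[OF assms, of x y] busemann_diff_le[OF assms, of y x]
      by (simp add: dist_real_def dist_commute)
  qed simp
qed

lemma midpoint_quasi_convex_imp_le_max:
  fixes f :: "real \<Rightarrow> real"
  assumes cont: "continuous_on {a..b} f"
    and mid: "\<And>s t. s \<in> {a..b} \<Longrightarrow> t \<in> {a..b} \<Longrightarrow> f ((s + t) / 2) \<le> max (f s) (f t)"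
    and t: "t \<in> {a..b}"
  shows "f t \<le> max (f a) (f b)"
proof (rule ccontr)
  define M where "M = max (f a) (f b)"
  assume "\<not> ?thesis"
  then have ft: "f t > M" by (simp add: M_def not_le)
  have compact: "compact {s \<in> {u..v}. f s \<le> M}" if "a \<le> u" "v \<le> b" for u v
  proof -
    have "closed {s \<in> {u..v}. f s \<le> M}"
      by (rule continuous_on_closed_Collect_le)
         (use that in \<open>auto intro: continuous_on_subset[OF cont]\<close>)
    then have "compact ({u..v} \<inter> {s \<in> {u..v}. f s \<le> M})"
      by (rule compact_Int_closed[OF compact_Icc])
    then show ?thesis
      by (simp only: Int_absorb1[OF Collect_restrict])
  qed
  \<comment> \<open>These sets contain \<open>a\<close> and \<open>b\<close> respectively.
    Compactness then yields the last point \<open>p\<close> before \<open>t\<close> and the first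
    point \<open>q\<close> after \<open>t\<close> at which \<open>f\<close> is at most
    \<open>M\<close>.\<close>
  have "{s \<in> {a..t}. f s \<le> M} \<noteq> {}" "{s \<in> {t..b}. f s \<le> M} \<noteq> {}"
    using t by (auto simp: M_def)
  then have "\<exists>p\<in>{s \<in> {a..t}. f s \<le> M}. \<forall>s\<in>{s \<in> {a..t}. f s \<le> M}. s \<le> p"
    "\<exists>q\<in>{s \<in> {t..b}. f s \<le> M}. \<forall>s\<in>{s \<in> {t..b}. f s \<le> M}. q \<le> s"
    using t by (intro compact_attains_sup compact_attains_inf compact; simp)+
  then obtain p q where p: "p \<in> {a..t}" "f p \<le> M" "\<And>s. s \<in> {a..t} \<Longrightarrow> f s \<le> M \<Longrightarrow> s \<le> p"
    and q: "q \<in> {t..b}" "f q \<le> M" "\<And>s. s \<in> {t..b} \<Longrightarrow> f s \<le> M \<Longrightarrow> q \<le> s"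
    by blast
  define r where "r = (p + q) / 2"
  have "p < t" "t < q"
    using p(1,2) q(1,2) ft by (auto simp: less_le)
  then have r: "p < r" "r < q" "a \<le> r" "r \<le> b"
    using p(1) q(1) by (auto simp: r_def)
  have "f r \<le> M"
    unfolding r_def using mid[of p q] p(1,2) q(1,2) t by simp
  \<comment> \<open>By the extremality of \<open>p\<close> and \<open>q\<close>, \<open>f\<close>
    exceeds \<open>M\<close> strictly between them, in particular at \<open>r\<close>.\<close>
  then show False
    using p(3)[of r] q(3)[of r] r by (cases "r \<le> t") auto
qed

lemma is_midpoint_geodesic:
  assumes "geodesic_from_to x y c" "s \<in> {0..1}" "t \<in> {0..1}"
  shows "is_midpoint (c ((s + t) / 2)) (c s) (c t)"
proof -
  have D: "dist (c u) (c v) = \<bar>u - v\<bar> * dist x y" if "u \<in> {0..1}" "v \<in> {0..1}" for u v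
    using assms(1) that unfolding geodesic_from_to_def by blast
  have "(s + t) / 2 \<in> {0..1}"
    using assms by auto
  moreover have "\<bar>s - (s + t) / 2\<bar> = \<bar>s - t\<bar> / 2" "\<bar>(s + t) / 2 - t\<bar> = \<bar>s - t\<bar> / 2"
    by (auto simp: abs_if field_simps)
  ultimately show ?thesis
    using assms D by (simp add: is_midpoint_def)
qed

lemma continuous_on_geodesic:
  assumes "geodesic_from_to x y c"
  shows "continuous_on {0..1} c"
proof (rule lipschitz_on_continuous_on)
  show "(dist x y)-lipschitz_on {0..1} c"
  proof (rule lipschitz_onI)
    show "dist (c s) (c t) \<le> dist x y * dist s t" if "s \<in> {0..1}" "t \<in> {0..1}" for s t
      using assms that unfolding geodesic_from_to_def dist_real_def
      by (metis mult.commute order_refl)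
  qed simp
qed

lemma quasi_convex_busemann:
  fixes \<gamma> :: "real \<Rightarrow> 'a::metric_space"
  assumes us: "uniformly_smooth TYPE('a)" and ray: "is_ray \<gamma>"
  shows "quasi_convex (busemann \<gamma>)"
  unfolding quasi_convex_def
proof (intro allI impI ballI)
  fix x y :: 'a and c t
  assume c: "geodesic_from_to x y c" and t: "t \<in> {0..1::real}"
  show "busemann \<gamma> (c t) \<le> max (busemann \<gamma> (c 0)) (busemann \<gamma> (c 1))"
  proof (rule midpoint_quasi_convex_imp_le_max[of 0 1 "\<lambda>s. busemann \<gamma> (c s)", OF _ _ t])
    show "continuous_on {0..1} (\<lambda>s. busemann \<gamma> (c s))"
      by (rule continuous_on_compose2[OF continuous_on_busemann[OF ray] continuous_on_geodesic[OF c]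
            subset_UNIV])
  qed (intro busemann_midpoint_le[OF us ray] is_midpoint_geodesic[OF c])
qed

text \<open>Each member is bounded along a geodesic by its own endpoint values, hence by the suprema
  there. Boundedness puts members below the real \<open>SUP\<close>; nonemptiness lets a common
  upper bound dominate it.\<close>

lemma quasi_convex_cSUP:
  fixes f :: "'i \<Rightarrow> 'a::metric_space \<Rightarrow> real"
  assumes "I \<noteq> {}" and bdd: "\<And>x. bdd_above ((\<lambda>i. f i x) ` I)"
    and qc: "\<And>i. i \<in> I \<Longrightarrow> quasi_convex (f i)"
  shows "quasi_convex (\<lambda>x. SUP i\<in>I. f i x)"
  unfolding quasi_convex_def
proof (intro allI impI ballI cSUP_least \<open>I \<noteq> {}\<close>)
  fix x y :: 'a and c :: "real \<Rightarrow> 'a" and t :: real and i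
  assume "geodesic_from_to x y c" "t \<in> {0..1}" "i \<in> I"
  then have "f i (c t) \<le> max (f i (c 0)) (f i (c 1))"
    using qc unfolding quasi_convex_def by blast
  also have "\<dots> \<le> max (SUP i\<in>I. f i (c 0)) (SUP i\<in>I. f i (c 1))"
    by (intro max.mono cSUP_upper bdd \<open>i \<in> I\<close>)
  finally show "f i (c t) \<le> max (SUP i\<in>I. f i (c 0)) (SUP i\<in>I. f i (c 1))" .
qed

theorem proposition3p4:
  assumes "proper_space TYPE('a::metric_space)"
    and "geodesic_space TYPE('a)"
    and "uniformly_smooth TYPE('a)"
  shows "(\<forall>\<gamma> :: real \<Rightarrow> 'a. is_ray \<gamma> \<longrightarrow> quasi_convex (busemann \<gamma>)) \<and>
         (\<forall>x\<^sub>0 :: 'a. (\<exists>\<gamma>. is_ray \<gamma> \<and> \<gamma> 0 = x\<^sub>0) \<longrightarrow> quasi_convex (cheeger_gromoll x\<^sub>0))"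
proof (intro conjI allI impI)
  show "quasi_convex (busemann \<gamma>)" if "is_ray \<gamma>" for \<gamma> :: "real \<Rightarrow> 'a"
    using quasi_convex_busemann[OF assms(3) that] .
  fix x\<^sub>0 :: 'a
  assume "\<exists>\<gamma>. is_ray \<gamma> \<and> \<gamma> 0 = x\<^sub>0"
  \<comment> \<open>The assumed ray makes the index set of the supremum nonempty.\<close>
  then show "quasi_convex (cheeger_gromoll x\<^sub>0)"
    unfolding cheeger_gromoll_def[abs_def]
    by (intro quasi_convex_cSUP bdd_above_busemann quasi_convex_busemann[OF assms(3)]) auto
qed

end
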